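(* Let $\mathbb{F}$ be a field with $\mathrm{char}(\mathbb{F})\neq2$, let $\mathbb{L}/\mathbb{F}$ be a cyclic Galois extension of degree $n$, and let $\sigma$ be a generator of $\mathrm{Gal}(\mathbb{L}/\mathbb{F})$. Let $\alpha_1,\ldots,\alpha_n$ be an $\mathbb{F}$-basis of $\mathbb{L}$, let $\beta_1,\ldots,\beta_n$ be its dual basis with respect to the trace inner product $(x,y)\mapsto\mathrm{Tr}_{\mathbb{L}/\mathbb{F}}(xy)$, and let $\gamma_1,\ldots,\gamma_n$ be an $\mathbb{F}$-basis of $\mathbb{L}$ such that $\sum_{j=1}^n\gamma_j\sigma^i(\alpha_j)=0$ for $i=0,\ldots,n-2$. Write $\beta=(\beta_1,\ldots,\beta_n)$ and $\gamma=(\gamma_1,\ldots,\gamma_n)$ as row vectors. Let $\ell\ge0$ be an integer with $2\ell\le n-2$. Then the space $$\left\{M\in\mathbb{F}^{n\times n}\;\middle|\;M^\top=M,\ \sigma^i(\gamma)M\beta^\top=0\text{ for }i=-(n-2-\ell),\ldots,-\ell\right\}$$ equals the image of $\mathcal{C}_{n-2\ell}^{n,2}(\sigma^{n-2-\ell}(\beta),\gamma)$ under the map $f\mapsto C_f$.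
   Context: For a field $K$, let $S_{n,d}(K)=K[x_1,\ldots,x_n]_d$ be the space of homogeneous polynomials of degree $d$ (including $0$), with differential operators $\partial_i$ acting by $\partial_i\circ f=\partial f/\partial x_i$; for $v\in K^n$ write $v(\partial)=v_1\partial_1+\ldots+v_n\partial_n$. $\sigma$ acts on $\mathbb{L}^n$ entrywise. For $1\le\rho\le n$ and $\mathbb{F}$-bases $\alpha^{(1)},\alpha^{(2)}\in\mathbb{L}^n$ of $\mathbb{L}$ (i.e. vectors whose entries form a basis), define $$\mathcal{C}_{\rho}^{n,2}(\alpha^{(1)},\alpha^{(2)})=\left\{f\in S_{n,2}(\mathbb{F})\;\middle|\;\alpha^{(1)}(\partial)\,\sigma^{s}(\alpha^{(2)})(\partial)\circ f=0\text{ for all integers }0\le s\le\rho-2\right\}.$$ For $f\in S_{n,2}(\mathbb{F})$, the first catalecticant matrix $C_f\in\mathbb{F}^{n\times n}$ is defined by $\partial_i\circ f=\sum_{j=1}^n(C_f)_{i,j}x_j$; it is symmetric, and $f\mapsto C_f$ is an isometry from $S_{n,2}(\mathbb{F})$ with the essential-rank metric onto the space of symmetric $n\times n$ matrices with the rank metric. *)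

theory Defs
  imports
    "HOL-Analysis.Analysis"
    "HOL-Library.Poly_Mapping"
    "HOL-Algebra.Generated_Groups"
begin

section \<open>Cyclic Galois extensions\<close>

text \<open>
  A field extension \<open>L/F\<close> is given by two field types \<open>'f\<close>, \<open>'l\<close> and an embedding
  \<open>\<iota> :: 'f \<Rightarrow> 'l\<close>.
\<close>

definition field_hom :: "('a::field \<Rightarrow> 'b::field) \<Rightarrow> bool" where
  "field_hom h \<longleftrightarrow>
     h 1 = 1 \<and> (\<forall>x y. h (x + y) = h x + h y) \<and> (\<forall>x y. h (x * y) = h x * h y)"

definition ext_scale :: "('f::field \<Rightarrow> 'l::field) \<Rightarrow> 'f \<Rightarrow> 'l \<Rightarrow> 'l" where
  "ext_scale \<iota> c x = \<iota> c * x"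

lemma vector_space_ext_scale: "field_hom \<iota> \<Longrightarrow> vector_space (ext_scale \<iota>)"
  by unfold_locales (auto simp: field_hom_def ext_scale_def algebra_simps)

definition Gal :: "('f::field \<Rightarrow> 'l::field) \<Rightarrow> ('l \<Rightarrow> 'l) monoid" where
  "Gal \<iota> = \<lparr>carrier = {\<tau>. bij \<tau> \<and> field_hom \<tau> \<and> (\<forall>c. \<tau> (\<iota> c) = \<iota> c)},
            monoid.mult = (\<circ>), one = id\<rparr>"

lemma group_Gal: "group (Gal \<iota>)"
proof (rule groupI)
  fix \<tau> assume \<tau>: "\<tau> \<in> carrier (Gal \<iota>)"
  then have bij: "bij \<tau>" and hom: "field_hom \<tau>" and fixes_F: "\<And>c. \<tau> (\<iota> c) = \<iota> c"
    by (auto simp: Gal_def)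
  have inv_eq: "inv_into UNIV \<tau> y = x" if "\<tau> x = y" for x y
    using bij that by (auto simp: bij_is_inj)
  have surj: "\<tau> (inv_into UNIV \<tau> y) = y" for y
    using bij by (simp add: bij_is_surj surj_f_inv_f)
  have "field_hom (inv_into UNIV \<tau>)"
    using hom unfolding field_hom_def by (auto intro!: inv_eq simp: surj)
  then have "inv_into UNIV \<tau> \<in> carrier (Gal \<iota>)"
    using bij fixes_F by (auto simp: Gal_def bij_imp_bij_inv intro!: inv_eq)
  moreover have "inv_into UNIV \<tau> \<circ> \<tau> = id"
    using bij by (simp add: bij_is_inj)
  ultimately show "\<exists>y\<in>carrier (Gal \<iota>). y \<otimes>\<^bsub>Gal \<iota>\<^esub> \<tau> = \<one>\<^bsub>Gal \<iota>\<^esub>"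
    by (auto simp: Gal_def)
qed (auto simp: Gal_def field_hom_def bij_comp comp_assoc)

definition finite_galois_extension :: "('f::field \<Rightarrow> 'l::field) \<Rightarrow> bool" where
  "finite_galois_extension \<iota> \<longleftrightarrow>
     field_hom \<iota> \<and>
     (\<exists>B. finite B \<and> module.span (ext_scale \<iota>) B = UNIV) \<and>
     {x. \<forall>\<tau>\<in>carrier (Gal \<iota>). \<tau> x = x} = range \<iota>"

definition ext_degree :: "('f::field \<Rightarrow> 'l::field) \<Rightarrow> nat" where
  "ext_degree \<iota> = vector_space.dim (ext_scale \<iota>) UNIV"

definition cyclic_galois_extension :: "('f::field \<Rightarrow> 'l::field) \<Rightarrow> ('l \<Rightarrow> 'l) \<Rightarrow> bool" where
  "cyclic_galois_extension \<iota> \<sigma> \<longleftrightarrow>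
     finite_galois_extension \<iota> \<and>
     \<sigma> \<in> carrier (Gal \<iota>) \<and> generate (Gal \<iota>) {\<sigma>} = carrier (Gal \<iota>)"

text \<open>
  The trace of \<open>x\<close> is the trace of the \<open>F\<close>-linear map \<open>y \<mapsto> x y\<close>, computed in some basis of
  the finite extension \<open>L/F\<close>; \<open>extend_basis {}\<close> is the library's choice of a basis.
\<close>

definition field_trace :: "('f::field \<Rightarrow> 'l::field) \<Rightarrow> 'l \<Rightarrow> 'f" where
  "field_trace \<iota> x =
     (let B = vector_space.extend_basis (ext_scale \<iota>) {}
      in \<Sum>b\<in>B. module.representation (ext_scale \<iota>) B (x * b) b)"

definition is_basis_vec :: "('f::field \<Rightarrow> 'l::field) \<Rightarrow> 'l^'n \<Rightarrow> bool" where
  "is_basis_vec \<iota> \<alpha> \<longleftrightarrow>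
     inj (($) \<alpha>) \<and> \<not> module.dependent (ext_scale \<iota>) (range (($) \<alpha>)) \<and>
     module.span (ext_scale \<iota>) (range (($) \<alpha>)) = UNIV"

definition is_trace_dual_basis :: "('f::field \<Rightarrow> 'l::field) \<Rightarrow> 'l^'n \<Rightarrow> 'l^'n \<Rightarrow> bool" where
  "is_trace_dual_basis \<iota> \<alpha> \<beta> \<longleftrightarrow>
     is_basis_vec \<iota> \<beta> \<and>
     (\<forall>i j. field_trace \<iota> (\<alpha> $ i * \<beta> $ j) = (if i = j then 1 else 0))"

definition entrywise :: "('l \<Rightarrow> 'l) \<Rightarrow> 'l^'n \<Rightarrow> 'l^'n" where
  "entrywise \<tau> v = (\<chi> j. \<tau> (v $ j))"


section \<open>Polynomials and differential operators\<close>

text \<open>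
  Polynomials over \<open>'a\<close> in the variables \<open>x\<^sub>i\<close>, \<open>i :: 'n\<close>: an exponent vector
  \<open>m :: 'n \<Rightarrow>\<^sub>0 nat\<close> stands for the monomial with exponent \<open>lookup m i\<close> at \<open>x\<^sub>i\<close>.
\<close>

type_synonym ('n, 'a) mpoly = "('n \<Rightarrow>\<^sub>0 nat) \<Rightarrow>\<^sub>0 'a"

definition const_poly :: "'a::field \<Rightarrow> ('n, 'a) mpoly" where
  "const_poly c = Poly_Mapping.single 0 c"

definition var_poly :: "'n \<Rightarrow> ('n, 'a::field) mpoly" where
  "var_poly i = Poly_Mapping.single (Poly_Mapping.single i 1) 1"

definition homogeneous_polys :: "nat \<Rightarrow> ('n::finite, 'a::field) mpoly set" where
  "homogeneous_polys d =
     {f. \<forall>m\<in>Poly_Mapping.keys f. (\<Sum>i\<in>UNIV. Poly_Mapping.lookup m i) = d}"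

definition partial_deriv :: "'n \<Rightarrow> ('n, 'a::field) mpoly \<Rightarrow> ('n, 'a) mpoly" where
  "partial_deriv i f =
     (\<Sum>m\<in>Poly_Mapping.keys f.
        Poly_Mapping.single (m - Poly_Mapping.single i 1)
          (of_nat (Poly_Mapping.lookup m i) * Poly_Mapping.lookup f m))"

definition dir_deriv :: "'a^'n \<Rightarrow> ('n::finite, 'a::field) mpoly \<Rightarrow> ('n, 'a) mpoly" where
  "dir_deriv v f = (\<Sum>i\<in>UNIV. const_poly (v $ i) * partial_deriv i f)"

text \<open>
  In the next definition a polynomial \<open>f\<close> over \<open>F\<close> is mapped to \<open>L[x\<^sub>1,\<dots>,x\<^sub>n]\<close> by applying
  \<open>\<iota>\<close> to its coefficients, as the operators have coefficients in \<open>L\<close>.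
\<close>

definition C_space ::
  "('f::field \<Rightarrow> 'l::field) \<Rightarrow> ('l \<Rightarrow> 'l) \<Rightarrow> nat \<Rightarrow> 'l^'n \<Rightarrow> 'l^'n \<Rightarrow> ('n::finite, 'f) mpoly set"
where
  "C_space \<iota> \<sigma> \<rho> \<alpha>1 \<alpha>2 =
     {f \<in> homogeneous_polys 2.
        \<forall>s::int. 0 \<le> s \<and> s \<le> int \<rho> - 2 \<longrightarrow>
          dir_deriv \<alpha>1 (dir_deriv (entrywise (\<sigma> [^]\<^bsub>Gal \<iota>\<^esub> s) \<alpha>2) (Poly_Mapping.map \<iota> f)) = 0}"

definition catalecticant :: "('n::finite, 'f::field) mpoly \<Rightarrow> 'f^'n^'n" where
  "catalecticant f =
     (\<chi> i j. Poly_Mapping.lookup (partial_deriv i f) (Poly_Mapping.single j 1))"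

lemma lookup_partial_deriv:
  fixes f :: "('n, 'a::field) mpoly"
  shows "Poly_Mapping.lookup (partial_deriv i f) m =
    of_nat (Poly_Mapping.lookup m i + 1) *
      Poly_Mapping.lookup f (m + Poly_Mapping.single i 1)"
proof -
  let ?e = "Poly_Mapping.single i (1::nat)"
  let ?t = "\<lambda>k. Poly_Mapping.lookup (Poly_Mapping.single (k - ?e)
          (of_nat (Poly_Mapping.lookup k i) * Poly_Mapping.lookup f k)) m"
  have zero: "?t k = 0" if "k \<noteq> m + ?e" for k
  proof (cases "Poly_Mapping.lookup k i = 0")
    case False
    have "k = (k - ?e) + ?e"
      using False by (intro poly_mapping_eqI)
        (auto simp: lookup_add lookup_minus lookup_single when_def)
    then show ?thesis
      using that by (auto simp: lookup_single when_def)
  qed simp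
  have "Poly_Mapping.lookup (partial_deriv i f) m = (\<Sum>k\<in>Poly_Mapping.keys f. ?t k)"
    by (simp add: partial_deriv_def lookup_sum)
  also have "\<dots> = (\<Sum>k\<in>Poly_Mapping.keys f \<union> {m + ?e}. ?t k)"
    by (intro sum.mono_neutral_left) (auto simp: in_keys_iff lookup_single when_def)
  also have "\<dots> = (\<Sum>k\<in>{m + ?e}. ?t k)"
    using zero by (intro sum.mono_neutral_right) auto
  also have "\<dots> = of_nat (Poly_Mapping.lookup m i + 1) * Poly_Mapping.lookup f (m + ?e)"
    by (simp add: lookup_single lookup_add)
  finally show ?thesis .
qed

lemma partial_deriv_eq_catalecticant:
  fixes f :: "('n::finite, 'f::field) mpoly"
  assumes f: "f \<in> homogeneous_polys 2"
  shows "partial_deriv i f = (\<Sum>j\<in>UNIV. const_poly (catalecticant f $ i $ j) * var_poly j)"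
proof (rule poly_mapping_eqI)
  fix m :: "'n \<Rightarrow>\<^sub>0 nat"
  let ?e = "\<lambda>j::'n. Poly_Mapping.single j (1::nat)"
  have rhs: "Poly_Mapping.lookup
      (\<Sum>j\<in>UNIV. const_poly (catalecticant f $ i $ j) * var_poly j) m =
      (\<Sum>j\<in>UNIV. if ?e j = m then catalecticant f $ i $ j else 0)"
    by (simp add: lookup_sum const_poly_def var_poly_def mult_single lookup_single when_def)
  show "Poly_Mapping.lookup (partial_deriv i f) m = Poly_Mapping.lookup
      (\<Sum>j\<in>UNIV. const_poly (catalecticant f $ i $ j) * var_poly j) m"
  proof (cases "\<exists>j. m = ?e j")
    case True
    then obtain j where m: "m = ?e j" by blast
    have "?e k = ?e j \<longleftrightarrow> k = j" for k
      by (metis lookup_single_eq lookup_single_not_eq zero_neq_one)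
    then show ?thesis
      unfolding rhs unfolding m by (simp add: catalecticant_def)
  next
    case False
    have "Poly_Mapping.lookup f (m + ?e i) = 0"
    proof (rule ccontr)
      assume "\<not> ?thesis"
      then have "(\<Sum>k\<in>UNIV. Poly_Mapping.lookup (m + ?e i) k) = 2"
        using f by (auto simp: homogeneous_polys_def in_keys_iff)
      then have "(\<Sum>k\<in>UNIV. Poly_Mapping.lookup m k) = 1"
        by (simp add: lookup_add sum.distrib lookup_single when_def)
      then obtain j where "Poly_Mapping.lookup m j = 1" "\<forall>k. k \<noteq> j \<longrightarrow> Poly_Mapping.lookup m k = 0"
        unfolding sum_eq_1_iff[OF finite] by auto
      then have "m = ?e j"
        by (intro poly_mapping_eqI) (auto simp: lookup_single when_def)
      with False show False by blast
    qed
    moreover have "?e j \<noteq> m" for j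
      using False by blast
    ultimately show ?thesis
      unfolding rhs by (simp add: lookup_partial_deriv)
  qed
qed

end

theory Submission
  imports Defs
begin

text \<open>
  Applying \<open>\<sigma>\<^sup>k\<close> with \<open>k = n - 2 - l\<close> to \<open>\<sigma>\<^sup>i(\<gamma>) M \<beta>\<^sup>T = 0\<close> leaves \<open>M\<close> unchanged and turns the
  condition into \<open>\<sigma>\<^sup>s(\<gamma>) M \<sigma>\<^sup>k(\<beta>)\<^sup>T = 0\<close> with \<open>s = i + k\<close> ranging over \<open>0, \<dots>, n - 2l - 2\<close>.
  For a quadratic form \<open>f\<close> with \<open>C\<^sub>f = M\<close>, the left-hand side is the constant polynomial
  \<open>\<sigma>\<^sup>k(\<beta>)(\<partial>) \<sigma>\<^sup>s(\<gamma>)(\<partial>) \<circ> f\<close>; outside characteristic 2, every symmetric matrix is some \<open>C\<^sub>f\<close>.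
\<close>

section \<open>Coefficients of derivatives and catalecticants\<close>

lemma lookup_const_poly_mult:
  "Poly_Mapping.lookup (const_poly c * p) m = c * Poly_Mapping.lookup p m"
proof -
  have "const_poly c * p = Poly_Mapping.map ((*) c) p"
    by (simp add: const_poly_def mult_map_scale_conv_mult)
  then show ?thesis
    by (simp add: Poly_Mapping.map.rep_eq when_def)
qed

lemma lookup_dir_deriv:
  "Poly_Mapping.lookup (dir_deriv v f) m =
     (\<Sum>i\<in>UNIV. v $ i * (of_nat (Poly_Mapping.lookup m i + 1) *
        Poly_Mapping.lookup f (m + Poly_Mapping.single i 1)))"
  unfolding dir_deriv_def
  by (simp only: lookup_sum lookup_const_poly_mult lookup_partial_deriv)

lemma catalecticant_component:
  "catalecticant f $ i $ j =
     of_nat (Poly_Mapping.lookup (Poly_Mapping.single j (1::nat)) i + 1) *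
     Poly_Mapping.lookup f (Poly_Mapping.single j 1 + Poly_Mapping.single i 1)"
  by (simp only: catalecticant_def lookup_partial_deriv vec_lambda_beta)

text \<open>Mixed partial derivatives commute: the exponent sum is symmetric in \<open>i\<close> and
  \<open>j\<close>, and the factor is 2 on the diagonal and 1 elsewhere.\<close>

lemma transpose_catalecticant: "transpose (catalecticant f) = catalecticant f"
  by (auto simp: vec_eq_iff transpose_def catalecticant_component add.commute
      lookup_single when_def)

lemma field_hom_0: "field_hom h \<Longrightarrow> h 0 = 0"
  unfolding field_hom_def by (metis add_cancel_right_right)

lemma lookup_map_field_hom:
  assumes "field_hom \<iota>"
  shows "Poly_Mapping.lookup (Poly_Mapping.map \<iota> f) m = \<iota> (Poly_Mapping.lookup f m)"
  using field_hom_0[OF assms] by (simp add: Poly_Mapping.map.rep_eq when_def)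

lemma field_hom_of_nat: "field_hom h \<Longrightarrow> h (of_nat k) = of_nat k"
  by (induction k) (auto simp: field_hom_0, simp_all add: field_hom_def)

lemma field_hom_sum: "field_hom h \<Longrightarrow> h (sum g A) = (\<Sum>x\<in>A. h (g x))"
  by (induction A rule: infinite_finite_induct)
     (auto simp: field_hom_0, simp_all add: field_hom_def)

lemma map_homogeneous_polys:
  assumes "field_hom \<iota>" "f \<in> homogeneous_polys d"
  shows "Poly_Mapping.map \<iota> f \<in> homogeneous_polys d"
  using assms
  by (auto simp: homogeneous_polys_def in_keys_iff lookup_map_field_hom field_hom_0)

lemma lookup_homogeneous_eq_0:
  assumes "f \<in> homogeneous_polys d" "(\<Sum>i\<in>UNIV. Poly_Mapping.lookup m i) \<noteq> d"
  shows "Poly_Mapping.lookup f m = 0"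
  using assms by (auto simp: homogeneous_polys_def in_keys_iff)

text \<open>Each entry is an integer multiple of a coefficient, so a field homomorphism passes
  through. This lets conditions over the extension be read off the matrix over the base
  field.\<close>

lemma catalecticant_map:
  assumes "field_hom \<iota>"
  shows "catalecticant (Poly_Mapping.map \<iota> f) = map_matrix \<iota> (catalecticant f)"
proof -
  have mult: "\<iota> (x * y) = \<iota> x * \<iota> y" for x y
    using assms by (simp add: field_hom_def)
  show ?thesis
    by (simp only: vec_eq_iff map_matrix_def vec_lambda_beta catalecticant_component
        lookup_map_field_hom[OF assms] mult field_hom_of_nat[OF assms]) simp
qed

text \<open>Two derivatives lower the degree from 2 to 0, so only the constant coefficient survives,
  and it is a value of the bilinear form of the catalecticant.\<close>

lemma dir_deriv_dir_deriv_quadratic: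
  fixes f :: "('n::finite, 'a::field) mpoly"
  assumes f: "f \<in> homogeneous_polys 2"
  shows "dir_deriv a (dir_deriv b f) = const_poly (scalar_product (b v* catalecticant f) a)"
proof (rule poly_mapping_eqI)
  fix m :: "'n \<Rightarrow>\<^sub>0 nat"
  let ?e = "\<lambda>j::'n. Poly_Mapping.single j (1::nat)"
  show "Poly_Mapping.lookup (dir_deriv a (dir_deriv b f)) m =
    Poly_Mapping.lookup (const_poly (scalar_product (b v* catalecticant f) a)) m"
  proof (cases "m = 0")
    case True
    have "Poly_Mapping.lookup (dir_deriv a (dir_deriv b f)) 0 =
        (\<Sum>i\<in>UNIV. a $ i * (\<Sum>k\<in>UNIV. b $ k * catalecticant f $ k $ i))"
      \<comment> \<open>The outer derivative contributes the factor \<open>0 + 1\<close>; the factor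
        of the inner one is already part of the catalecticant entry.\<close>
      by (simp only: lookup_dir_deriv catalecticant_component) simp
    also have "\<dots> = scalar_product (b v* catalecticant f) a"
      by (simp add: scalar_product_def vector_matrix_mult_def mult.commute)
    finally show ?thesis
      using True by (simp add: const_poly_def)
  next
    case False
    then obtain j where "Poly_Mapping.lookup m j \<noteq> 0"
      by (metis poly_mapping_eqI lookup_zero)
    then have "(\<Sum>i\<in>UNIV. Poly_Mapping.lookup m i) \<noteq> 0"
      by auto
    \<comment> \<open>For nonzero \<open>m\<close> this exponent has total degree at least
      3.\<close>
    then have "Poly_Mapping.lookup f (m + ?e i + ?e k) = 0" for i k
      by (intro lookup_homogeneous_eq_0[OF f])
         (simp add: lookup_add sum.distrib lookup_single when_def)
    then have "Poly_Mapping.lookup (dir_deriv a (dir_deriv b f)) m = 0"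
      by (simp add: lookup_dir_deriv)
    then show ?thesis
      using False by (simp add: const_poly_def lookup_single when_def)
  qed
qed

section \<open>Symmetric matrices as catalecticants\<close>

lemma single_add_single_eq_iff:
  "Poly_Mapping.single i (1::nat) + Poly_Mapping.single j 1 =
     Poly_Mapping.single k 1 + Poly_Mapping.single l 1 \<longleftrightarrow>
   i = k \<and> j = l \<or> i = l \<and> j = k" (is "?L \<longleftrightarrow> ?R")
proof
  assume ?L
  then have "Poly_Mapping.lookup (Poly_Mapping.single i (1::nat) + Poly_Mapping.single j 1) x =
      Poly_Mapping.lookup (Poly_Mapping.single k 1 + Poly_Mapping.single l 1) x" for x
    by simp
  \<comment> \<open>Comparing the exponents at the four variables involved determines the unordered
    pair.\<close>
  from this[of i] this[of j] this[of k] this[of l] show ?R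
    by (auto simp: lookup_add lookup_single when_def split: if_splits)
qed (auto simp: add.commute)

lemma two_neq_0_if_CHAR_neq_2:
  assumes "CHAR('a::field) \<noteq> 2"
  shows "(2::'a) \<noteq> 0"
proof
  assume "(2::'a) = 0"
  then have "of_nat 2 = (0::'a)"
    by simp
  then have "CHAR('a) dvd 2"
    by (simp only: of_nat_eq_0_iff_char_dvd)
  then have "CHAR('a) = 1 \<or> CHAR('a) = 2"
    using two_is_prime_nat unfolding prime_nat_iff by blast
  with assms show False
    using CHAR_not_1'[where ?'a = 'a] by simp
qed

text \<open>The witness is half the quadratic form of \<open>M\<close>, that is
  \<open>x\<^sup>T M x / 2\<close>; dividing by 2 is where the characteristic matters.\<close>

lemma symmetric_is_catalecticant:
  fixes M :: "'f::field^'n^'n"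
  assumes "CHAR('f) \<noteq> 2" and sym: "transpose M = M"
  obtains f where "f \<in> homogeneous_polys 2" "catalecticant f = M"
proof
  let ?e = "\<lambda>j::'n. Poly_Mapping.single j (1::nat)"
  define f :: "('n, 'f) mpoly" where
    "f = (\<Sum>i\<in>UNIV. \<Sum>j\<in>UNIV. Poly_Mapping.single (?e i + ?e j) (M $ i $ j / 2))"
  have two: "(2::'f) \<noteq> 0"
    using assms(1) by (rule two_neq_0_if_CHAR_neq_2)
  have M_sym: "M $ j $ i = M $ i $ j" for i j
    using sym by (metis transpose_def vec_lambda_beta)
  have lookup_f: "Poly_Mapping.lookup f m =
      (\<Sum>i\<in>UNIV. \<Sum>j\<in>UNIV. if ?e i + ?e j = m then M $ i $ j / 2 else 0)" for m
    by (simp add: f_def lookup_sum lookup_single when_def)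
  show "f \<in> homogeneous_polys 2"
    unfolding homogeneous_polys_def
  proof safe
    fix m assume "m \<in> Poly_Mapping.keys f"
    then have "Poly_Mapping.lookup f m \<noteq> 0"
      by (simp add: in_keys_iff)
    then have "\<exists>i j. ?e i + ?e j = m"
      unfolding lookup_f by (rule contrapos_np) (auto intro!: sum.neutral)
    then obtain i j where "m = ?e i + ?e j"
      by blast
    then show "(\<Sum>i\<in>UNIV. Poly_Mapping.lookup m i) = 2"
      by (simp add: lookup_add sum.distrib lookup_single when_def)
  qed
  have "catalecticant f $ k $ l = M $ k $ l" for k l
  proof (cases "k = l")
    case True
    \<comment> \<open>A square arises from one index pair only; differentiating it gives the factor
      2 that cancels the half.\<close>
    have "Poly_Mapping.lookup f (?e k + ?e k) =
        (\<Sum>i\<in>UNIV. \<Sum>j\<in>UNIV. if j = k then (if i = k then M $ i $ j / 2 else 0) else 0)"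
      unfolding lookup_f single_add_single_eq_iff by (intro sum.cong refl) auto
    also have "\<dots> = M $ k $ k / 2"
      by simp
    finally have "Poly_Mapping.lookup f (?e k + ?e k) = M $ k $ k / 2" .
    then show ?thesis
      unfolding catalecticant_component True[symmetric] using two by (simp add: mult.commute)
  next
    case False
    \<comment> \<open>A mixed monomial arises from two distinct index pairs, so the conditional
      splits into a sum. By symmetry of \<open>M\<close> the two halves add up to one entry, and
      differentiation contributes the factor 1.\<close>
    have "Poly_Mapping.lookup f (?e l + ?e k) =
        (\<Sum>i\<in>UNIV. \<Sum>j\<in>UNIV. (if j = k then (if i = l then M $ i $ j / 2 else 0) else 0) +
           (if j = l then (if i = k then M $ i $ j / 2 else 0) else 0))"
      unfolding lookup_f single_add_single_eq_iff using False by (intro sum.cong refl) auto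
    also have "\<dots> = M $ l $ k / 2 + M $ k $ l / 2"
      by (simp add: sum.distrib)
    also have "\<dots> = M $ k $ l"
      unfolding M_sym[of l k] using two by (simp add: field_simps)
    finally have "Poly_Mapping.lookup f (?e l + ?e k) = M $ k $ l" .
    then show ?thesis
      unfolding catalecticant_component using False by (simp add: lookup_single when_def)
  qed
  then show "catalecticant f = M"
    by (simp add: vec_eq_iff)
qed

section \<open>The Galois action on the bilinear conditions\<close>

text \<open>The entries of \<open>M\<close> come from the base field and are fixed by
  \<open>\<tau>\<close>, so \<open>\<tau>\<close> can be pulled out of the whole expression.\<close>

lemma scalar_product_entrywise:
  assumes "\<tau> \<in> carrier (Gal \<iota>)"
  shows "scalar_product (entrywise \<tau> u v* map_matrix \<iota> M) (entrywise \<tau> w) =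
    \<tau> (scalar_product (u v* map_matrix \<iota> M) w)"
proof -
  have hom: "field_hom \<tau>" and fixed: "\<And>c. \<tau> (\<iota> c) = \<iota> c"
    using assms by (auto simp: Gal_def)
  then have mult: "\<tau> (x * y) = \<tau> x * \<tau> y" for x y
    by (simp add: field_hom_def)
  show ?thesis
    by (simp add: scalar_product_def vector_matrix_mult_def entrywise_def map_matrix_def
        field_hom_sum[OF hom] mult fixed)
qed

lemma Gal_eq_0_iff:
  assumes "\<tau> \<in> carrier (Gal \<iota>)"
  shows "\<tau> x = 0 \<longleftrightarrow> x = 0"
proof -
  have "inj \<tau>" "field_hom \<tau>"
    using assms by (auto simp: Gal_def bij_is_inj)
  then show ?thesis
    by (metis field_hom_0 injD)
qed

theorem proposition5p16:
  fixes \<iota> :: "'f::field \<Rightarrow> 'l::field"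
    and \<sigma> :: "'l \<Rightarrow> 'l"
    and \<alpha> \<beta> \<gamma> :: "'l^'n"
    and n l :: nat
  assumes "CHAR('f) \<noteq> 2"
    and "n = CARD('n)"
    and "cyclic_galois_extension \<iota> \<sigma>"
    and "ext_degree \<iota> = n"
    and "is_basis_vec \<iota> \<alpha>"
    and "is_trace_dual_basis \<iota> \<alpha> \<beta>"
    and "is_basis_vec \<iota> \<gamma>"
    and "\<And>i::int. 0 \<le> i \<Longrightarrow> i \<le> int n - 2 \<Longrightarrow>
           (\<Sum>j\<in>UNIV. \<gamma> $ j * (\<sigma> [^]\<^bsub>Gal \<iota>\<^esub> i) (\<alpha> $ j)) = 0"
    and "2 * int l \<le> int n - 2"
  shows "{M :: 'f^'n^'n. transpose M = M \<and>
           (\<forall>i::int. - (int n - 2 - int l) \<le> i \<and> i \<le> - int l \<longrightarrow>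
              scalar_product (entrywise (\<sigma> [^]\<^bsub>Gal \<iota>\<^esub> i) \<gamma> v* map_matrix \<iota> M) \<beta> = 0)} =
         catalecticant ` C_space \<iota> \<sigma> (n - 2 * l)
           (entrywise (\<sigma> [^]\<^bsub>Gal \<iota>\<^esub> (int n - 2 - int l)) \<beta>) \<gamma>"
proof -
  have hom: "field_hom \<iota>" and \<sigma>: "\<sigma> \<in> carrier (Gal \<iota>)"
    using assms(3) by (auto simp: cyclic_galois_extension_def finite_galois_extension_def)
  define pow where "pow = (\<lambda>i::int. \<sigma> [^]\<^bsub>Gal \<iota>\<^esub> i)"
  \<comment> \<open>Adding this shift moves the index interval from \<open>-k, ..., -l\<close> to
    one starting at 0.\<close>
  define k where "k = int n - 2 - int l"
  have pow_Gal: "pow i \<in> carrier (Gal \<iota>)" for i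
    unfolding pow_def using \<sigma> group.int_pow_closed[OF group_Gal] by blast
  have pow_add: "pow k (pow i x) = pow (i + k) x" for i x
  proof -
    have "pow (k + i) = pow k \<otimes>\<^bsub>Gal \<iota>\<^esub> pow i"
      unfolding pow_def by (rule group.int_pow_mult[OF group_Gal \<sigma>])
    then show ?thesis
      by (simp add: Gal_def add.commute)
  qed
  have shift: "scalar_product (entrywise (pow i) \<gamma> v* map_matrix \<iota> M) \<beta> = 0 \<longleftrightarrow>
      scalar_product (entrywise (pow (i + k)) \<gamma> v* map_matrix \<iota> M) (entrywise (pow k) \<beta>) = 0"
    for i and M :: "'f^'n^'n"
  proof -
    have "entrywise (pow (i + k)) \<gamma> = entrywise (pow k) (entrywise (pow i) \<gamma>)"
      by (simp add: entrywise_def pow_add)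
    then show ?thesis
      by (simp add: scalar_product_entrywise[OF pow_Gal] Gal_eq_0_iff[OF pow_Gal])
  qed
  \<comment> \<open>The bound on \<open>l\<close> keeps the natural subtraction from truncating, so
    the upper ends of the shifted interval and of the range in \<open>C_space\<close> agree.\<close>
  have range: "int (n - 2 * l) - 2 = - int l + k"
    using assms(9) by (simp add: k_def)
  have conditions: "(\<forall>i::int. - k \<le> i \<and> i \<le> - int l \<longrightarrow>
        scalar_product (entrywise (pow i) \<gamma> v* map_matrix \<iota> M) \<beta> = 0) \<longleftrightarrow>
      (\<forall>s::int. 0 \<le> s \<and> s \<le> int (n - 2 * l) - 2 \<longrightarrow>
        scalar_product (entrywise (pow s) \<gamma> v* map_matrix \<iota> M) (entrywise (pow k) \<beta>) = 0)"
    (is "?L \<longleftrightarrow> ?R") for M :: "'f^'n^'n"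
  proof
    assume L: ?L
    show ?R
    proof (intro allI impI)
      fix s :: int assume "0 \<le> s \<and> s \<le> int (n - 2 * l) - 2"
      then show "scalar_product (entrywise (pow s) \<gamma> v* map_matrix \<iota> M) (entrywise (pow k) \<beta>) = 0"
        using L[rule_format, of "s - k"] shift[of "s - k" M] range by simp
    qed
  next
    assume R: ?R
    show ?L
      using R shift range by simp
  qed
  have C_space_iff: "f \<in> C_space \<iota> \<sigma> (n - 2 * l) (entrywise (pow k) \<beta>) \<gamma> \<longleftrightarrow>
      f \<in> homogeneous_polys 2 \<and>
      (\<forall>s::int. 0 \<le> s \<and> s \<le> int (n - 2 * l) - 2 \<longrightarrow>
        scalar_product (entrywise (pow s) \<gamma> v* map_matrix \<iota> (catalecticant f))
          (entrywise (pow k) \<beta>) = 0)" for f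
  proof -
    \<comment> \<open>This turns the vanishing of the twice differentiated polynomial into a scalar
      equation.\<close>
    have "const_poly c = (0 :: ('n, 'l) mpoly) \<longleftrightarrow> c = 0" for c
      by (metis const_poly_def lookup_single_eq lookup_zero single_zero)
    then show ?thesis
      by (auto simp: C_space_def pow_def map_homogeneous_polys[OF hom]
          dir_deriv_dir_deriv_quadratic catalecticant_map[OF hom])
  qed
  show ?thesis
    unfolding pow_def[symmetric] k_def[symmetric] conditions
  proof (intro equalityI subsetI)
    fix M :: "'f^'n^'n"
    assume M: "M \<in> {M. transpose M = M \<and>
      (\<forall>s::int. 0 \<le> s \<and> s \<le> int (n - 2 * l) - 2 \<longrightarrow>
        scalar_product (entrywise (pow s) \<gamma> v* map_matrix \<iota> M) (entrywise (pow k) \<beta>) = 0)}"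
    \<comment> \<open>Once \<open>M\<close> is written as a catalecticant, both sides impose the
      same conditions; the reverse inclusion rests on the symmetry of catalecticants.\<close>
    then obtain f where "f \<in> homogeneous_polys 2" "catalecticant f = M"
      using symmetric_is_catalecticant[OF assms(1)] by blast
    with M show "M \<in> catalecticant ` C_space \<iota> \<sigma> (n - 2 * l) (entrywise (pow k) \<beta>) \<gamma>"
      by (auto simp: C_space_iff)
  qed (auto simp: C_space_iff transpose_catalecticant)
qed

end
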